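(* Let $\mathbb{X}$ be a normed space, let $x_0\in\mathbb{X}$ with $\|x_0\|=1$, let $x^*$ be the bounded linear functional induced by $x_0$ and let $\mathbb{X}_{x_0}^+$ be the extensible cone induced by $x_0$. If $f:[a,b]\to\mathbb{X}$ is an increasing function in $(\mathbb{X},\mathbb{X}_{x_0}^+)$, then $x^*\circ f:[a,b]\to\mathbb{R}$ is increasing and $f\sim_{x_0}g$, where $g(t)=(x^*\circ f)(t)\,x_0$ for $t\in[a,b]$.
   Context: Normed spaces are real, and $\mathbb{X}^*$ is the space of bounded linear functionals on $\mathbb{X}$. Induced functional and cone: for $x_0\in\mathbb{X}\setminus\{0\}$, the functional $y^*(\beta x_0)=\beta\|x_0\|^2$ on $\mathrm{span}\{x_0\}$ has norm $\|x_0\|$; let $x^*\in\mathbb{X}^*$ be a fixed norm-preserving Hahn–Banach extension (so $x^*(x_0)=\|x_0\|^2$ and $\|x^*\|=\|x_0\|$), called the bounded linear functional induced by $x_0$. The induced (extensible) cone is $\mathbb{X}_{x_0}^+=\{x\in\mathbb{X}:x^*(x)\ge\alpha\|x\|\}$ for a fixed $\alpha\in(0,\|x_0\|]$. For functions $f_1,f_2:[a,b]\to\mathbb{X}$, $f_1\sim_{x_0}f_2$ means $x^*(f_1(t))=x^*(f_2(t))$ for all $t\in[a,b]$. $[a,b]=\{t:a\le t\le b\}$ is an order interval in a real ordered vector space (for instance a closed interval of $\mathbb{R}$). A function $g:[a,b]\to\mathbb{X}$ is increasing in $(\mathbb{X},\mathbb{X}_{x_0}^+)$ if $s\le t$ in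 $[a,b]$ implies $g(t)-g(s)\in\mathbb{X}_{x_0}^+$; a real-valued function $h$ on $[a,b]$ is increasing if $s\le t$ implies $h(s)\le h(t)$. *)

theory Defs
  imports "HOL-Analysis.Analysis"
begin

text \<open>
  \<open>xs\<close> is a bounded linear functional induced by \<open>x0\<close>: it extends the functional
  \<open>\<beta> x0 \<mapsto> \<beta> \<parallel>x0\<parallel>\<^sup>2\<close> on \<open>span {x0}\<close>, whose norm is \<open>\<parallel>x0\<parallel>\<close>, and preserves that norm.
  Such an extension need not be unique, so this is a relation; "the" induced functional
  is any fixed \<open>xs\<close> satisfying it.
\<close>

definition induced_functional ::
    "'a::real_normed_vector \<Rightarrow> ('a \<Rightarrow>\<^sub>L real) \<Rightarrow> bool" where
  "induced_functional x0 xs \<longleftrightarrow>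
     x0 \<noteq> 0 \<and>
     (\<forall>\<beta>. blinfun_apply xs (\<beta> *\<^sub>R x0) = \<beta> * (norm x0)\<^sup>2) \<and>
     norm xs = norm x0"

text \<open>
  The parameter \<open>\<alpha>\<close> is meant to satisfy \<open>0 < \<alpha> \<le> \<parallel>x0\<parallel>\<close>, where \<open>xs\<close> is induced by \<open>x0\<close>.
\<close>

definition induced_cone ::
    "('a::real_normed_vector \<Rightarrow>\<^sub>L real) \<Rightarrow> real \<Rightarrow> 'a set" where
  "induced_cone xs \<alpha> = {x. blinfun_apply xs x \<ge> \<alpha> * norm x}"

definition increasing_wrt_cone ::
    "'v::order set \<Rightarrow> 'a::real_normed_vector set \<Rightarrow> ('v \<Rightarrow> 'a) \<Rightarrow> bool" where
  "increasing_wrt_cone I C f \<longleftrightarrow> monotone_on I (\<le>) (\<lambda>x y. y - x \<in> C) f"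

definition functional_equiv_on ::
    "'v set \<Rightarrow> ('a::real_normed_vector \<Rightarrow>\<^sub>L real) \<Rightarrow> ('v \<Rightarrow> 'a) \<Rightarrow> ('v \<Rightarrow> 'a) \<Rightarrow> bool" where
  "functional_equiv_on I xs f1 f2 \<longleftrightarrow>
     (\<forall>t\<in>I. blinfun_apply xs (f1 t) = blinfun_apply xs (f2 t))"

end

theory Submission
  imports Defs
begin

theorem corollary4p8:
  fixes x0 :: "'a::real_normed_vector"
    and xs :: "'a \<Rightarrow>\<^sub>L real"
    and \<alpha> :: real
    and a b :: "'v::ordered_real_vector"
    and f :: "'v \<Rightarrow> 'a"
  assumes "norm x0 = 1"
    and "induced_functional x0 xs"
    and "0 < \<alpha>" and "\<alpha> \<le> norm x0"
    and "increasing_wrt_cone {a..b} (induced_cone xs \<alpha>) f"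
  shows "mono_on {a..b} (blinfun_apply xs \<circ> f) \<and>
         functional_equiv_on {a..b} xs f (\<lambda>t. (blinfun_apply xs \<circ> f) t *\<^sub>R x0)"
proof
  show "mono_on {a..b} (blinfun_apply xs \<circ> f)"
  proof (rule mono_onI)
    fix s t assume "s \<in> {a..b}" "t \<in> {a..b}" "s \<le> t"
    then have "f t - f s \<in> induced_cone xs \<alpha>"
      using assms(5) by (auto simp: increasing_wrt_cone_def dest: monotone_onD)
    then have "\<alpha> * norm (f t - f s) \<le> blinfun_apply xs (f t - f s)"
      by (simp add: induced_cone_def)
    \<comment> \<open>The functional is nonnegative on the cone because \<open>\<alpha>\<close> is positive; linearity
      turns nonnegativity on increments into monotonicity.\<close>
    moreover have "0 \<le> \<alpha> * norm (f t - f s)"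
      using assms(3) by simp
    ultimately show "(blinfun_apply xs \<circ> f) s \<le> (blinfun_apply xs \<circ> f) t"
      by (simp add: blinfun.diff_right)
  qed
next
  \<comment> \<open>For a unit vector \<open>x0\<close> the functional sends \<open>\<beta> *\<^sub>R x0\<close> to \<open>\<beta>\<close>, so replacing a vector
    by its multiple of \<open>x0\<close> with coefficient its functional value keeps that value.\<close>
  show "functional_equiv_on {a..b} xs f (\<lambda>t. (blinfun_apply xs \<circ> f) t *\<^sub>R x0)"
    using assms(1,2) by (simp add: functional_equiv_on_def induced_functional_def)
qed

end
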